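(* If $1-\pi(M^*|\mathbf{D})=o_p(1)$ as $n\to\infty$ (global model selection consistency), then $$\sup_{A\in\mathcal{F}}\left|\Pi(A|\mathbf{D})-\Pi(A|M^*,\mathbf{D})\right|=o_p(1)\quad\text{as } n\to\infty,$$ where $\mathcal{F}$ is the set of all measurable events (the oracle property for Bayesian model averaging).
   Context: $\mathbf{D}$ is the observed data with sample size $n$. There is a countable sequence of candidate models $M_1,M_2,\ldots$, one of which is the true model $M^*$. Model $M_j$ has prior probability $\pi(M_j)$ and proposes a prior $\pi(\theta|M_j)$ for a parameter $\theta$, supported on $\Theta_j$; $\Theta=\cup_j\Theta_j$. Given a nonnegative likelihood or quasi-likelihood $L(\mathbf{D}|\theta,M_j)$ (for example $p(\mathbf{D}|\theta,M_j)$, or $e^{-\lambda R_n(\mathbf{D}|\theta,M_j)}$ for an empirical risk $R_n$ and $\lambda>0$), the joint posterior of $(\theta,M)$ is proportional to $L(\mathbf{D}|\theta,M_j)\pi(\theta|M_j)\pi(M_j)$, normalized to a probability distribution. $\Pi(\cdot|\mathbf{D})$ denotes this posterior probability measure (model averaging), $\pi(M_j|\mathbf{D})$ is the posterior probability of the model $M_j$, and $\Pi(\cdot|M_j,\mathbf{D})$ is the posterior conditional on $M=M_j$, so that $\Pi(A|\mathbf{D})=\sum_{j\ge1}\pi(M_j|\mathbf{D})\,\Pi(A|M_j,\mathbf{D})$. $\Pi(\cdot|M^*,\mathbf{D})$ is called the oracle posterior. Measurable events are events concerning $(\theta,M)$, including those concerning $\theta$ only. All these quantities depend on $n$; $o_p(1)$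 is with respect to the probability measure of $\mathbf{D}$ as $n\to\infty$. *)

theory Defs
  imports "HOL-Probability.Probability"
begin

text \<open>
  The sequence of models is indexed by \<^typ>\<open>nat\<close>, and the pair of a parameter and a model
  is represented as \<open>(\<theta>, j)\<close>.  The sigma-algebra on these pairs contains in particular the events
  \<open>B \<times> UNIV\<close>, which concern the parameter only.
\<close>

definition param_model_space :: "'a measure \<Rightarrow> ('a \<times> nat) measure" where
  "param_model_space T = T \<Otimes>\<^sub>M count_space UNIV"

definition joint_prior ::
    "'a measure \<Rightarrow> nat pmf \<Rightarrow> (nat \<Rightarrow> 'a measure) \<Rightarrow> ('a \<times> nat) measure" where
  "joint_prior T mprior pprior =
     measure_pmf mprior \<bind> (\<lambda>j. distr (pprior j) (param_model_space T) (\<lambda>\<theta>. (\<theta>, j)))"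

definition evidence ::
    "'a measure \<Rightarrow> nat pmf \<Rightarrow> (nat \<Rightarrow> 'a measure) \<Rightarrow> ('a \<Rightarrow> nat \<Rightarrow> real) \<Rightarrow> ennreal" where
  "evidence T mprior pprior lik =
     (\<integral>\<^sup>+(\<theta>, j). ennreal (lik \<theta> j) \<partial>joint_prior T mprior pprior)"

definition posterior ::
    "'a measure \<Rightarrow> nat pmf \<Rightarrow> (nat \<Rightarrow> 'a measure) \<Rightarrow> ('a \<Rightarrow> nat \<Rightarrow> real) \<Rightarrow> ('a \<times> nat) measure" where
  "posterior T mprior pprior lik =
     density (joint_prior T mprior pprior)
       (\<lambda>(\<theta>, j). ennreal (lik \<theta> j) / evidence T mprior pprior lik)"

definition model_event :: "'a measure \<Rightarrow> nat \<Rightarrow> ('a \<times> nat) set" where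
  "model_event T j = {x \<in> space (param_model_space T). snd x = j}"

definition model_posterior ::
    "'a measure \<Rightarrow> nat pmf \<Rightarrow> (nat \<Rightarrow> 'a measure) \<Rightarrow> ('a \<Rightarrow> nat \<Rightarrow> real) \<Rightarrow> nat \<Rightarrow> real" where
  "model_posterior T mprior pprior lik j = measure (posterior T mprior pprior lik) (model_event T j)"

text \<open>
  \<^const>\<open>uniform_measure\<close> is elementary conditioning: it maps \<open>A\<close> to \<open>\<mu> (B \<inter> A) / \<mu> B\<close>.
  If \<open>B\<close> is a null set it is the zero measure.
\<close>

definition posterior_given_model ::
    "'a measure \<Rightarrow> nat pmf \<Rightarrow> (nat \<Rightarrow> 'a measure) \<Rightarrow> ('a \<Rightarrow> nat \<Rightarrow> real) \<Rightarrow> nat \<Rightarrow> ('a \<times> nat) measure"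
  where
  "posterior_given_model T mprior pprior lik j =
     uniform_measure (posterior T mprior pprior lik) (model_event T j)"

text \<open>
  The setting for one sample size.  \<open>D\<close> is the law of the data and \<open>lik d \<theta> j\<close> is the
  (quasi-)likelihood of \<open>\<theta>\<close> in model \<open>j\<close>; \<open>pprior j\<close> is a measure on the whole of \<open>T\<close>
  concentrated on \<open>\<Theta> j\<close>, so \<open>lik d \<theta> j\<close> is immaterial for \<open>\<theta> \<notin> \<Theta> j\<close> and may be set to \<open>0\<close>
  there.
\<close>

locale bayesian_model_averaging =
  fixes D :: "'d measure"
    and T :: "'a measure"
    and \<Theta> :: "nat \<Rightarrow> 'a set"
    and mprior :: "nat pmf"
    and pprior :: "nat \<Rightarrow> 'a measure"
    and lik :: "'d \<Rightarrow> 'a \<Rightarrow> nat \<Rightarrow> real"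
  assumes prob_space_data: "prob_space D"
    and space_param: "space T = (\<Union>j. \<Theta> j)"
    and sets_Theta: "\<And>j. \<Theta> j \<in> sets T"
    and sets_pprior: "\<And>j. sets (pprior j) = sets T"
    and prob_space_pprior: "\<And>j. prob_space (pprior j)"
    and pprior_supported: "\<And>j. AE \<theta> in pprior j. \<theta> \<in> \<Theta> j"
    and lik_nonneg: "\<And>d \<theta> j. d \<in> space D \<Longrightarrow> \<theta> \<in> \<Theta> j \<Longrightarrow> 0 \<le> lik d \<theta> j"
    and lik_measurable: "\<And>j. (\<lambda>(d, \<theta>). lik d \<theta> j) \<in> borel_measurable (D \<Otimes>\<^sub>M T)"
    and normalizable:
      "AE d in D. 0 < evidence T mprior pprior (lik d) \<and> evidence T mprior pprior (lik d) < \<infinity>"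

text \<open>
  \<open>X n = o\<^sub>p(1)\<close> for random variables \<open>X n\<close> on probability spaces \<open>P n\<close> that may change with \<open>n\<close>.
  Measurability is part of the notion because \<^const>\<open>measure\<close> is \<open>0\<close> on non-measurable sets.
\<close>

definition little_o_p_1 :: "(nat \<Rightarrow> 'd measure) \<Rightarrow> (nat \<Rightarrow> 'd \<Rightarrow> real) \<Rightarrow> bool" where
  "little_o_p_1 P X \<longleftrightarrow>
     (\<forall>n. X n \<in> borel_measurable (P n)) \<and>
     (\<forall>\<epsilon>>0. (\<lambda>n. measure (P n) {d \<in> space (P n). \<bar>X n d\<bar> > \<epsilon>}) \<longlonglongrightarrow> 0)"

end

theory Submission
  imports Defs
begin

text \<open>
  Conditioning a probability measure on an event \<open>B\<close> moves it by exactly \<open>1 - P B\<close> in total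
  variation, the supremum being attained at the complement of \<open>B\<close>.  So wherever the posterior is
  normalizable, the distance to the oracle posterior equals \<open>1 - \<pi>(M\<^sup>*|D)\<close>.  On the exceptional
  null set the posterior is the zero measure and the distance is \<open>0\<close>; this and the measurability
  of the evidence make the distance a random variable.
\<close>

text \<open>For the upper bound, let \<open>r\<close> be the conditional probability of
  \<open>A\<close> given \<open>B\<close>. Then \<open>prob A - r\<close> is
  \<open>prob (A - B)\<close> minus \<open>r * (1 - prob B)\<close>, and both terms lie between 0
  and \<open>1 - prob B\<close>.\<close>

lemma (in prob_space) SUP_diff_uniform_measure:
  assumes B: "B \<in> events"
  shows "(SUP A\<in>events. \<bar>prob A - measure (uniform_measure M B) A\<bar>) = 1 - prob B"
proof -
  \<comment> \<open>This also covers \<open>prob B = 0\<close>: the left side comes from 0 / 0 = 0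
    in \<open>ennreal\<close>, and division by 0 in the reals gives 0 as well.\<close>
  have cond: "measure (uniform_measure M B) A = prob (A \<inter> B) / prob B" if "A \<in> events" for A
  proof (cases "prob B = 0")
    case True
    then have "emeasure M B = 0" by (simp add: emeasure_eq_measure)
    moreover have "emeasure M (B \<inter> A) = 0"
      using emeasure_mono[of "B \<inter> A" B M] B \<open>emeasure M B = 0\<close> by simp
    ultimately show ?thesis
      using True B that by (simp add: measure_def)
  next
    case False
    then show ?thesis
      using B that by (subst measure_uniform_measure) (auto simp: emeasure_eq_measure Int_commute)
  qed
  show ?thesis
  proof (rule cSup_eq_maximum)
    have "prob ((space M - B) \<inter> B) = 0"
      by (simp add: Int_commute)
    then have "\<bar>prob (space M - B) - measure (uniform_measure M B) (space M - B)\<bar> = 1 - prob B"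
      using B by (simp add: cond prob_compl)
    then show "1 - prob B \<in> (\<lambda>A. \<bar>prob A - measure (uniform_measure M B) A\<bar>) ` events"
      using B by (intro image_eqI[of _ _ "space M - B"]) auto
  next
    fix x assume "x \<in> (\<lambda>A. \<bar>prob A - measure (uniform_measure M B) A\<bar>) ` events"
    then obtain A where A: "A \<in> events" and x: "x = \<bar>prob A - prob (A \<inter> B) / prob B\<bar>"
      using cond by auto
    have split: "prob A = prob (A \<inter> B) + prob (A - B)"
      using finite_measure_Diff'[OF A B] by simp
    have out: "prob (A - B) \<le> 1 - prob B"
      using finite_measure_mono[of "A - B" "space M - B"] A B sets.sets_into_space[OF A]
      by (auto simp: prob_compl)
    have inn: "prob (A \<inter> B) \<le> prob B"
      using A B by (intro finite_measure_mono) auto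
    show "x \<le> 1 - prob B"
    proof (cases "prob B = 0")
      case True
      then show ?thesis by (simp add: x)
    next
      case False
      then have pos: "0 < prob B" by (simp add: zero_less_measure_iff)
      define r where "r = prob (A \<inter> B) / prob B"
      have r: "0 \<le> r" "r \<le> 1" "prob (A \<inter> B) = r * prob B"
        using pos inn by (auto simp: r_def)
      have "r * (1 - prob B) \<le> 1 - prob B" "0 \<le> r * (1 - prob B)"
        using r by (auto intro: mult_left_le_one_le)
      moreover have "prob A - r = prob (A - B) - r * (1 - prob B)"
        by (simp add: split r(3) algebra_simps)
      moreover have "0 \<le> prob (A - B)" by simp
      ultimately show ?thesis
        using out unfolding x r_def[symmetric] by linarith
    qed
  qed
qed

lemma SUP_diff_uniform_measure_null:
  assumes null: "emeasure M (space M) = 0" and B: "B \<in> sets M"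
  shows "(SUP A\<in>sets M. \<bar>measure M A - measure (uniform_measure M B) A\<bar>) = 0"
proof -
  have zero: "emeasure M A = 0" for A
    using emeasure_space[of M A] null by simp
  have "\<bar>measure M A - measure (uniform_measure M B) A\<bar> = 0" if "A \<in> sets M" for A
    using that B by (simp add: measure_def zero)
  \<comment> \<open>The whole space witnesses that the family is nonempty, so its real supremum is
    that of a singleton.\<close>
  then have "(\<lambda>A. \<bar>measure M A - measure (uniform_measure M B) A\<bar>) ` sets M = {0}"
    using sets.top[of M] by (auto simp: image_iff intro!: bexI[of _ "space M"])
  then show ?thesis by (simp only: cSup_singleton)
qed

context bayesian_model_averaging
begin

lemma prob_space_joint_prior: "prob_space (joint_prior T mprior pprior)"
  and sets_joint_prior [measurable_cong]:
    "sets (joint_prior T mprior pprior) = sets (param_model_space T)"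
proof -
  define K where "K j = distr (pprior j) (param_model_space T) (\<lambda>\<theta>. (\<theta>, j))" for j
  have [measurable]: "(\<lambda>\<theta>. (\<theta>, j)) \<in> pprior j \<rightarrow>\<^sub>M param_model_space T" for j
    unfolding param_model_space_def measurable_cong_sets[OF sets_pprior refl] by measurable
  have K_prob: "prob_space (K j)" for j
    unfolding K_def by (intro prob_space.prob_space_distr prob_space_pprior) measurable
  have K_sets: "sets (K j) = sets (param_model_space T)" for j
    by (simp add: K_def)
  \<comment> \<open>Every set of models is measurable, so only the values of \<open>K\<close> have
    to be checked.\<close>
  have K: "K \<in> measure_pmf mprior \<rightarrow>\<^sub>M subprob_algebra (param_model_space T)"
    by (auto simp: measurable_def space_subprob_algebra K_sets prob_space_imp_subprob_space K_prob)
  have eq: "joint_prior T mprior pprior = measure_pmf mprior \<bind> K"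
    by (simp add: joint_prior_def K_def[abs_def])
  show "prob_space (joint_prior T mprior pprior)"
    unfolding eq by (rule measure_pmf.prob_space_bind[OF _ K]) (simp add: K_prob)
  show "sets (joint_prior T mprior pprior) = sets (param_model_space T)"
    unfolding eq by (rule sets_bind[OF K_sets]) simp
qed

text \<open>The likelihood is measurable for each fixed model, and there are countably many models
  to glue along. Including \<open>d\<close> among the arguments is what later makes the evidence
  measurable in the data.\<close>

lemma measurable_lik_joint:
  "(\<lambda>(d, \<theta>, j). ennreal (lik d \<theta> j)) \<in> borel_measurable (D \<Otimes>\<^sub>M param_model_space T)"
proof -
  have [measurable]: "(\<lambda>x. ennreal (lik (fst x) (fst (snd x)) j))
      \<in> borel_measurable (D \<Otimes>\<^sub>M param_model_space T)" for j
  proof -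
    have "(\<lambda>x. (fst x, fst (snd x))) \<in> D \<Otimes>\<^sub>M param_model_space T \<rightarrow>\<^sub>M D \<Otimes>\<^sub>M T"
      unfolding param_model_space_def by measurable
    from measurable_compose[OF this lik_measurable[of j]] show ?thesis
      by (simp add: case_prod_beta)
  qed
  have [measurable]: "(\<lambda>x. snd (snd x)) \<in> D \<Otimes>\<^sub>M param_model_space T \<rightarrow>\<^sub>M count_space UNIV"
    unfolding param_model_space_def by measurable
  have "(\<lambda>x. ennreal (lik (fst x) (fst (snd x)) (snd (snd x))))
      \<in> borel_measurable (D \<Otimes>\<^sub>M param_model_space T)"
    by (rule measurable_compose_countable[where g = "\<lambda>x. snd (snd x)"
          and f = "\<lambda>j x. ennreal (lik (fst x) (fst (snd x)) j)"]) measurable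
  then show ?thesis by (simp add: case_prod_beta)
qed

lemma measurable_lik:
  assumes "d \<in> space D"
  shows "(\<lambda>(\<theta>, j). ennreal (lik d \<theta> j)) \<in> borel_measurable (joint_prior T mprior pprior)"
  unfolding measurable_cong_sets[OF sets_joint_prior refl]
  using measurable_compose[OF measurable_Pair1'[OF assms] measurable_lik_joint] by simp

lemma measurable_evidence:
  "(\<lambda>d. evidence T mprior pprior (lik d)) \<in> borel_measurable D"
proof -
  interpret J: prob_space "joint_prior T mprior pprior" by (rule prob_space_joint_prior)
  have "(\<lambda>(d, x). case x of (\<theta>, j) \<Rightarrow> ennreal (lik d \<theta> j))
      \<in> borel_measurable (D \<Otimes>\<^sub>M joint_prior T mprior pprior)"
    using measurable_lik_joint
    by (simp cong: measurable_cong_sets sets_pair_measure_cong add: sets_joint_prior)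
  from J.borel_measurable_nn_integral[OF this] show ?thesis
    by (simp add: evidence_def)
qed

lemma sets_posterior:
  "sets (posterior T mprior pprior L) = sets (param_model_space T)"
  by (simp add: posterior_def sets_joint_prior)

lemma model_event_sets: "model_event T j \<in> sets (param_model_space T)"
  unfolding model_event_def param_model_space_def by measurable

text \<open>
  Both exceptional values of the evidence give the zero measure: in \<^typ>\<open>ennreal\<close>, both
  \<open>0 / 0\<close> and \<open>\<infinity> / \<infinity>\<close> are \<open>0\<close>.
\<close>
lemma emeasure_posterior_space:
  assumes "d \<in> space D"
  shows "emeasure (posterior T mprior pprior (lik d)) (space (posterior T mprior pprior (lik d)))
    = (if 0 < evidence T mprior pprior (lik d) \<and> evidence T mprior pprior (lik d) < \<infinity>
       then 1 else 0)"
proof -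
  define J where "J = joint_prior T mprior pprior"
  define e where "e = evidence T mprior pprior (lik d)"
  have m [measurable]: "(\<lambda>(\<theta>, j). ennreal (lik d \<theta> j)) \<in> borel_measurable J"
    unfolding J_def by (rule measurable_lik[OF assms])
  have "(\<lambda>(\<theta>, j). ennreal (lik d \<theta> j) / e) = (\<lambda>x. (case x of (\<theta>, j) \<Rightarrow> ennreal (lik d \<theta> j)) / e)"
    by auto
  then have "emeasure (posterior T mprior pprior (lik d)) (space J)
      = (\<integral>\<^sup>+x. (case x of (\<theta>, j) \<Rightarrow> ennreal (lik d \<theta> j)) / e \<partial>J)"
    unfolding posterior_def J_def[symmetric] e_def[symmetric]
    by (simp add: emeasure_density cong: nn_integral_cong)
  also have "\<dots> = e / e"
    by (simp add: nn_integral_divide) (simp add: e_def evidence_def J_def)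
  also have "\<dots> = (if 0 < e \<and> e < \<infinity> then 1 else 0)"
    by (auto simp: zero_less_iff_neq_zero less_top)
  finally show ?thesis
    by (simp add: e_def J_def posterior_def)
qed

text \<open>The supremum runs over a possibly uncountable family, so its measurability in
  \<open>d\<close> is not immediate; this closed form settles it. It holds at every data point, not
  just almost surely, because \<open>little_o_p_1\<close> asks for measurability on the whole
  space.\<close>

lemma SUP_diff_posterior_given_model:
  assumes "d \<in> space D"
  shows "(SUP A \<in> sets (param_model_space T).
           \<bar>measure (posterior T mprior pprior (lik d)) A
            - measure (posterior_given_model T mprior pprior (lik d) j) A\<bar>)
    = (if 0 < evidence T mprior pprior (lik d) \<and> evidence T mprior pprior (lik d) < \<infinity>
       then 1 - model_posterior T mprior pprior (lik d) j else 0)"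
proof -
  let ?P = "posterior T mprior pprior (lik d)"
  have B: "model_event T j \<in> sets ?P"
    by (simp add: sets_posterior model_event_sets)
  show ?thesis
  proof (cases "0 < evidence T mprior pprior (lik d) \<and> evidence T mprior pprior (lik d) < \<infinity>")
    case True
    then interpret prob_space ?P
      using emeasure_posterior_space[OF assms] by (intro prob_spaceI) simp
    show ?thesis
      using SUP_diff_uniform_measure[OF B] True
      by (simp add: sets_posterior posterior_given_model_def model_posterior_def)
  next
    case False
    then have "emeasure ?P (space ?P) = 0"
      using emeasure_posterior_space[OF assms] by auto
    from SUP_diff_uniform_measure_null[OF this B] show ?thesis
      using False by (auto simp: sets_posterior posterior_given_model_def)
  qed
qed

end

text \<open>The event that \<open>X n\<close> exceeds \<epsilon> is contained in the one for
  \<open>Y n\<close>. Domination says nothing about measurability, so that of \<open>X n\<close> is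
  a separate premise.\<close>

lemma little_o_p_1_dominated:
  assumes fin: "\<And>n. finite_measure (P n)"
    and Y: "little_o_p_1 P Y"
    and X: "\<And>n. X n \<in> borel_measurable (P n)"
    and le: "\<And>n d. d \<in> space (P n) \<Longrightarrow> \<bar>X n d\<bar> \<le> \<bar>Y n d\<bar>"
  shows "little_o_p_1 P X"
  unfolding little_o_p_1_def
proof (intro conjI allI impI X)
  fix \<epsilon> :: real assume "0 < \<epsilon>"
  have [measurable]: "Y n \<in> borel_measurable (P n)" for n
    using Y by (simp add: little_o_p_1_def)
  have "measure (P n) {d \<in> space (P n). \<bar>X n d\<bar> > \<epsilon>}
      \<le> measure (P n) {d \<in> space (P n). \<bar>Y n d\<bar> > \<epsilon>}" for n
    using le[of _ n] by (intro finite_measure.finite_measure_mono[OF fin]) (force, measurable)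
  moreover have "(\<lambda>n. measure (P n) {d \<in> space (P n). \<bar>Y n d\<bar> > \<epsilon>}) \<longlonglongrightarrow> 0"
    using Y \<open>0 < \<epsilon>\<close> by (simp add: little_o_p_1_def)
  ultimately show "(\<lambda>n. measure (P n) {d \<in> space (P n). \<bar>X n d\<bar> > \<epsilon>}) \<longlonglongrightarrow> 0"
    by - (rule Lim_null_comparison[OF always_eventually], simp_all)
qed

theorem theorem1:
  fixes D :: "nat \<Rightarrow> 'd measure"
    and T :: "nat \<Rightarrow> 'a measure"
    and \<Theta> :: "nat \<Rightarrow> nat \<Rightarrow> 'a set"
    and mprior :: "nat \<Rightarrow> nat pmf"
    and pprior :: "nat \<Rightarrow> nat \<Rightarrow> 'a measure"
    and lik :: "nat \<Rightarrow> 'd \<Rightarrow> 'a \<Rightarrow> nat \<Rightarrow> real"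
    and true_model :: "nat \<Rightarrow> nat"
  assumes setting: "\<And>n. bayesian_model_averaging (D n) (T n) (\<Theta> n) (mprior n) (pprior n) (lik n)"
    and selection_consistency:
      "little_o_p_1 D (\<lambda>n d. 1 - model_posterior (T n) (mprior n) (pprior n) (lik n d) (true_model n))"
  shows "little_o_p_1 D (\<lambda>n d. SUP A \<in> sets (param_model_space (T n)).
           \<bar>measure (posterior (T n) (mprior n) (pprior n) (lik n d)) A
            - measure (posterior_given_model (T n) (mprior n) (pprior n) (lik n d) (true_model n)) A\<bar>)"
    (is "little_o_p_1 D ?X")
proof (rule little_o_p_1_dominated[OF _ selection_consistency])
  fix n
  interpret bayesian_model_averaging "D n" "T n" "\<Theta> n" "mprior n" "pprior n" "lik n"
    by (rule setting)
  show "finite_measure (D n)"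
    using prob_space_data by (rule prob_space.finite_measure)
  \<comment> \<open>Measurability of the posterior model probability in \<open>d\<close> is part of
    the consistency hypothesis.\<close>
  have [measurable]:
    "(\<lambda>d. 1 - model_posterior (T n) (mprior n) (pprior n) (lik n d) (true_model n))
      \<in> borel_measurable (D n)"
    using selection_consistency by (simp add: little_o_p_1_def)
  note measurable_evidence [measurable]
  show "?X n \<in> borel_measurable (D n)"
    by (subst measurable_cong[OF SUP_diff_posterior_given_model]) (assumption, measurable)
  \<comment> \<open>Only an inequality holds at every \<open>d\<close>: where the posterior is the
    zero measure, the left side is 0 and the right side is 1.\<close>
  show "\<bar>?X n d\<bar>
      \<le> \<bar>1 - model_posterior (T n) (mprior n) (pprior n) (lik n d) (true_model n)\<bar>"
    if "d \<in> space (D n)" for d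
    by (simp add: SUP_diff_posterior_given_model[OF that])
qed

end
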